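(* Let $P_n(z) = a_n \prod_{j=1}^n (z-z_j) = \sum_{k=0}^n a_k z^k$ be a polynomial with complex coefficients, $a_n \neq 0$, with roots $z_1,\ldots,z_n\in\mathbb{C}$ listed with multiplicity. If $P_n$ has no roots in $\mathbb{D}$, then $\|P_n\|_0 = M(P_n) = |a_0|$. Otherwise, $$\|P_n\|_0 = M(P_n)\, \exp\left(\frac{1}{2} \sum_{|z_j| < 1} (|z_j|^2-1) \right),$$ where the sum is over all indices $j\in\{1,\ldots,n\}$ with $|z_j|<1$.
   Context: $\mathbb{D}=\{z\in\mathbb{C}:|z|<1\}$ is the open unit disk and $dA$ is the area (Lebesgue) measure. For a nonzero polynomial $P$ with complex coefficients, Mahler's measure is $$M(P) := \exp\left(\frac{1}{2\pi}\int_0^{2\pi}\log|P(e^{i\theta})|\,d\theta\right),$$ and its areal analog is $$\|P\|_0 := \exp\left(\frac{1}{\pi}\iint_{\mathbb{D}}\log|P(z)|\,dA\right).$$ *)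

theory Defs
  imports "HOL-Analysis.Analysis" "HOL-Computational_Algebra.Polynomial"
begin

text \<open>In both definitions the logarithm is applied to \<^term>\<open>0\<close> only at zeros of the polynomial;
  for a nonzero polynomial these form a finite set, so the library's convention for
  \<^term>\<open>ln 0\<close> does not affect the integrals.\<close>

definition mahler_measure :: "complex poly \<Rightarrow> real" where
  "mahler_measure P = exp (1 / (2 * pi) * (LBINT \<theta>=0..2*pi. ln (cmod (poly P (exp (\<i> * of_real \<theta>))))))"

text \<open>\<^term>\<open>lborel :: complex measure\<close> is the two-dimensional (area) Borel-Lebesgue measure,
  and \<^term>\<open>ball 0 1 :: complex set\<close> is the open unit disk.\<close>

definition areal_mahler_measure :: "complex poly \<Rightarrow> real" where
  "areal_mahler_measure P = exp (1 / pi * (LBINT z:ball 0 1. ln (cmod (poly P z))))"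

end

theory Submission
  imports Defs "HOL-Complex_Analysis.Cauchy_Integral_Formula"
begin

text \<open>Both integrals are additive over the linear factors. On the circle, the mean value property of
  \<open>ln \<bar>1 - c z\<bar>\<close> gives Jensen's formula: the mean of \<open>ln \<bar>z e\<^sup>i\<^sup>t - w\<bar>\<close> is \<open>ln (max \<bar>z\<bar> \<bar>w\<bar>)\<close>. Over the disk,
  area measure is invariant under rotations, so that \<open>ln \<bar>z - w\<bar>\<close> may be replaced by this mean, whose
  integral is elementary: it is \<open>\<pi> (\<bar>w\<bar>\<^sup>2 - 1) / 2\<close> for \<open>\<bar>w\<bar> < 1\<close> and \<open>\<pi> ln \<bar>w\<bar>\<close> otherwise.\<close>

section \<open>Rotation invariance of area measure on the complex plane\<close>

text \<open>Boxes determine \<open>lborel\<close>, and the preimage of a box is its image under the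
  inverse map, which is again orthogonal and so preserves Lebesgue measure.\<close>

lemma distr_lborel_orthogonal_transformation:
  fixes T :: "real ^ 'n::{finite,wellorder} \<Rightarrow> real ^ 'n::_"
  assumes T: "orthogonal_transformation T"
  shows "distr lborel borel T = lborel"
proof (rule sym, rule lborel_eqI)
  have [measurable]: "T \<in> borel_measurable borel"
    using T by (intro borel_measurable_continuous_onI linear_continuous_on)
      (simp add: orthogonal_transformation_linear linear_conv_bounded_linear[symmetric])
  fix l u :: "real ^ 'n::_" assume le: "\<And>b. b \<in> Basis \<Longrightarrow> l \<bullet> b \<le> u \<bullet> b"
  have eq: "T -` box l u = inv T ` box l u"
    by (rule bij_vimage_eq_inv_image[OF orthogonal_transformation_bij[OF T]])
  have inv: "orthogonal_transformation (inv T)"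
    by (rule orthogonal_transformation_inv[OF T])
  have box: "box l u \<in> lmeasurable"
    by simp
  have "T -` box l u \<in> sets borel"
    using measurable_sets[of T borel borel "box l u"] by simp
  then have "emeasure lborel (T -` box l u) = emeasure lebesgue (inv T ` box l u)"
    unfolding eq[symmetric] by simp
  also have "\<dots> = ennreal (measure lebesgue (inv T ` box l u))"
    using measurable_orthogonal_image[OF inv box] by (rule emeasure_eq_measure2)
  also have "measure lebesgue (inv T ` box l u) = measure lebesgue (box l u)"
    by (rule measure_orthogonal_image[OF inv box])
  also have "ennreal \<dots> = (\<Prod>b\<in>Basis. (u - l) \<bullet> b)"
    using le by (simp add: measure_lborel_box_eq)
  finally show "emeasure (distr lborel borel T) (box l u) = (\<Prod>b\<in>Basis. (u - l) \<bullet> b)"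
    by (simp add: emeasure_distr)
qed simp

text \<open>Serves to carry invariance from \<open>real ^ 2\<close> over to \<open>complex\<close>:
  under the identification of coordinates, a box pulls back to a box with the same side
  lengths.\<close>

lemma lborel_complex_eq_distr:
  "(lborel :: complex measure) = distr lborel borel (\<lambda>v :: real ^ 2. Complex (v $ 1) (v $ 2))"
proof (rule lborel_eqI)
  have [measurable]: "(\<lambda>v :: real ^ 2. Complex (v $ 1) (v $ 2)) \<in> borel_measurable borel"
    unfolding Complex_eq by (intro borel_measurable_continuous_onI continuous_intros)
  fix l u :: complex assume le: "\<And>b. b \<in> Basis \<Longrightarrow> l \<bullet> b \<le> u \<bullet> b"
  let ?l = "vector [Re l, Im l] :: real ^ 2" and ?u = "vector [Re u, Im u] :: real ^ 2"
  have "(\<lambda>v :: real ^ 2. Complex (v $ 1) (v $ 2)) -` box l u = box ?l ?u"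
    by (auto simp: in_box_complex_iff mem_box_cart forall_2)
  moreover have "Re l \<le> Re u" "Im l \<le> Im u"
    using le[of 1] le[of \<i>] by (auto simp: Basis_complex_def)
  ultimately show "emeasure (distr lborel borel (\<lambda>v :: real ^ 2. Complex (v $ 1) (v $ 2))) (box l u)
      = (\<Prod>b\<in>Basis. (u - l) \<bullet> b)"
    by (simp add: emeasure_distr emeasure_lborel_box_eq Basis_complex_def Basis_vec_def
        inner_axis UN_Un UNIV_2 axis_eq_axis)
qed simp

text \<open>Read in the coordinates of \<open>real ^ 2\<close>, multiplication by \<open>u\<close>
  is a linear map \<open>T\<close> that preserves the norm because \<open>cmod u = 1\<close>; hence
  \<open>T\<close> is orthogonal.\<close>

lemma distr_lborel_complex_rotation:
  assumes u: "cmod u = 1"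
  shows "distr lborel borel ((*) u) = lborel"
proof -
  define \<Psi> where "\<Psi> = (\<lambda>v :: real ^ 2. Complex (v $ 1) (v $ 2))"
  define T where "T = (\<lambda>v :: real ^ 2. vector [Re (u * \<Psi> v), Im (u * \<Psi> v)] :: real ^ 2)"
  have [measurable]: "\<Psi> \<in> borel_measurable borel"
    unfolding \<Psi>_def Complex_eq by (intro borel_measurable_continuous_onI continuous_intros)
  have norm: "norm v = cmod (\<Psi> v)" for v
    by (simp add: norm_vec_def L2_set_def sum_2 cmod_def \<Psi>_def)
  have lin: "linear T"
    by (rule linearI) (simp_all add: T_def \<Psi>_def vec_eq_iff forall_2 algebra_simps)
  have \<Psi>T: "\<Psi> (T v) = u * \<Psi> v" for v
    by (simp add: \<Psi>_def T_def complex_eq_iff)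
  have orth: "orthogonal_transformation T"
    unfolding orthogonal_transformation using lin by (simp add: norm \<Psi>T norm_mult u)
  have [measurable]: "T \<in> borel_measurable borel"
    using lin by (intro borel_measurable_continuous_onI linear_continuous_on)
      (simp add: linear_conv_bounded_linear)
  have "distr lborel borel ((*) u) = distr (distr lborel borel \<Psi>) borel ((*) u)"
    using lborel_complex_eq_distr by (simp add: \<Psi>_def)
  also have "\<dots> = distr lborel borel (\<lambda>v. u * \<Psi> v)"
    by (subst distr_distr) (simp_all add: o_def)
  also have "\<dots> = distr lborel borel (\<lambda>v. \<Psi> (T v))"
    by (simp add: \<Psi>T)
  also have "\<dots> = distr (distr lborel borel T) borel \<Psi>"
    by (subst distr_distr) (simp_all add: o_def)
  also have "\<dots> = lborel"
    using lborel_complex_eq_distr by (simp add: \<Psi>_def distr_lborel_orthogonal_transformation[OF orth])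
  finally show ?thesis .
qed

section \<open>Circle means of the logarithm of a linear factor\<close>

text \<open>For \<open>cmod c < 1\<close> the values \<open>1 - c * z\<close> on the closed disk
  have positive real part, so \<open>Ln (1 - c * z)\<close> is holomorphic there and Cauchy's
  formula gives its circle mean as the value at the centre, \<open>Ln 1 = 0\<close>.\<close>

lemma circle_mean_value:
  assumes c: "cmod c < 1"
  shows "((\<lambda>t. ln (cmod (1 - c * cis t))) has_integral 0) {0..2 * pi}"
proof -
  define f where "f = (\<lambda>z. Ln (1 - c * z))"
  have small: "cmod (c * z) < 1" if "cmod z \<le> 1" for z
    using mult_left_mono[OF that norm_ge_zero[of c]] c by (simp add: norm_mult)
  have pos: "Re (1 - c * z) > 0" if "cmod z \<le> 1" for z
    using small[OF that] complex_Re_le_cmod[of "c * z"] by simp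
  have "f holomorphic_on cball 0 1"
    unfolding f_def by (intro holomorphic_intros) (use pos in \<open>fastforce simp: complex_nonpos_Reals_iff\<close>)
  then have "((\<lambda>z. f z / (z - 0)) has_contour_integral 2 * of_real pi * \<i> * f 0) (circlepath 0 1)"
    by (rule Cauchy_integral_circlepath_simple) simp
  then have "((\<lambda>t. f (cis t) * \<i>) has_integral 0) {0..2 * pi}"
    by (simp add: circlepath_def has_contour_integral_part_circlepath_iff f_def)
  \<comment> \<open>On the circle, \<open>dz / z\<close> is \<open>\<i> dt\<close>. Because of the
    factor \<open>\<i>\<close>, the imaginary part picks out \<open>Re (f (cis t))\<close>, the
    logarithm of the modulus.\<close>
  then have "((\<lambda>t. Im (f (cis t) * \<i>)) has_integral Im 0) {0..2 * pi}"
    by (rule has_integral_Im)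
  moreover have "Im (f (cis t) * \<i>) = ln (cmod (1 - c * cis t))" for t
  proof -
    have "1 - c * cis t \<noteq> 0"
      using small[of "cis t"] by auto
    then show ?thesis
      by (simp add: f_def)
  qed
  ultimately show ?thesis
    by simp
qed

text \<open>Restricted measures turn both domains into finite measure spaces, so that one general
  statement about polynomials can serve the circle and the disk alike.\<close>

abbreviation circle_angles :: "real measure"
  where "circle_angles \<equiv> restrict_space lborel {0..2 * pi}"

abbreviation disk_measure :: "complex measure"
  where "disk_measure \<equiv> restrict_space lborel (ball 0 1)"

lemma has_bochner_integral_Icc_continuous:
  fixes f :: "real \<Rightarrow> real"
  assumes "continuous_on {a..b} f" "(f has_integral I) {a..b}"
  shows "has_bochner_integral (restrict_space lborel {a..b}) f I"
  using borel_integrable_atLeastAtMost'[OF assms(1)] set_borel_integral_eq_integral(2)[of "{a..b}" f]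
    integral_unique[OF assms(2)]
  by (simp add: has_bochner_integral_iff integrable_restrict_space integral_restrict_space set_integrable_def
      set_lebesgue_integral_def)

lemma circle_integral_const: "has_bochner_integral circle_angles (\<lambda>_. k :: real) (2 * pi * k)"
  using has_integral_const_real[of k 0 "2 * pi"]
  by (intro has_bochner_integral_Icc_continuous) auto

text \<open>Pulling out \<open>- w\<close> leaves \<open>1 - (z / w) * cis t\<close> with
  \<open>cmod (z / w) < 1\<close>, whose logarithm has mean zero.\<close>

lemma circle_integral_ln_less:
  assumes "cmod z < cmod w"
  shows "has_bochner_integral circle_angles (\<lambda>t. ln (cmod (z * cis t - w))) (2 * pi * ln (cmod w))"
proof (rule has_bochner_integral_Icc_continuous)
  have w: "w \<noteq> 0" and zw: "cmod (z / w) < 1"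
    using assms by (auto simp: norm_divide divide_simps)
  have nz: "z * cis t \<noteq> w" for t
    using assms by (metis norm_cis mult.right_neutral norm_mult less_irrefl)
  show "continuous_on {0..2 * pi} (\<lambda>t. ln (cmod (z * cis t - w)))"
    using nz by (intro continuous_intros) auto
  have "((\<lambda>t. ln (cmod w) + ln (cmod (1 - (z / w) * cis t))) has_integral (2 * pi * ln (cmod w) + 0)) {0..2 * pi}"
    using has_integral_const_real[of "ln (cmod w)" 0 "2 * pi"]
    by (intro has_integral_add circle_mean_value zw) auto
  moreover have "ln (cmod w) + ln (cmod (1 - (z / w) * cis t)) = ln (cmod (z * cis t - w))" for t
  proof -
    have "z * cis t - w = - (w * (1 - (z / w) * cis t))"
      using w by (simp add: field_simps)
    moreover have "1 - (z / w) * cis t \<noteq> 0"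
      using nz[of t] w by (auto simp: field_simps)
    ultimately show ?thesis
      using w by (simp add: norm_mult ln_mult del: minus_mult_right)
  qed
  ultimately show "((\<lambda>t. ln (cmod (z * cis t - w))) has_integral 2 * pi * ln (cmod w)) {0..2 * pi}"
    by simp
qed

lemma circle_integral_ln:
  assumes "cmod z \<noteq> cmod w"
  shows "has_bochner_integral circle_angles (\<lambda>t. ln (cmod (z * cis t - w)))
    (2 * pi * ln (max (cmod z) (cmod w)))"
proof (cases "cmod z < cmod w")
  case True
  then show ?thesis
    using circle_integral_ln_less[OF True] by simp
next
  case False
  \<comment> \<open>Conjugating and then multiplying by the unimodular \<open>cis t\<close> swaps
    the roles of \<open>z\<close> and \<open>w\<close>, which reduces this case to the previous
    one.\<close>
  have "cmod (cnj w * cis t - cnj z) = cmod (z * cis t - w)" for t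
  proof -
    have "cmod (cnj w * cis t - cnj z) = cmod (cnj (cnj w * cis t - cnj z))"
      by (simp only: complex_mod_cnj)
    also have "\<dots> = cmod (cis t * (w * cis (- t) - z))"
      by (simp add: norm_mult cis_cnj)
    also have "cis t * (w * cis (- t) - z) = w * (cis t * cis (- t)) - z * cis t"
      by (simp add: algebra_simps)
    finally show ?thesis
      by (simp add: cis_mult norm_minus_commute)
  qed
  with False show ?thesis
    using assms circle_integral_ln_less[of "cnj w" "cnj z"] by simp
qed

text \<open>Any two solutions of \<open>cis t = w\<close> differ by an integer multiple of
  \<open>2 * pi\<close>, so the solutions form a countable null set.\<close>

lemma AE_circle_neq: "AE t in circle_angles. cis t \<noteq> w"
proof -
  have "countable {t. cis t = w}"
  proof (cases "\<exists>t. cis t = w")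
    case True
    then obtain s where s: "cis s = w" by blast
    have "{t. cis t = w} \<subseteq> range (\<lambda>k :: int. s + 2 * pi * k)"
      using s by (auto simp: complex_eq_iff image_iff) (metis sin_cos_eq_iff)
    then show ?thesis
      by (rule countable_subset) simp
  qed simp
  then have "{t. cis t = w} \<in> null_sets lborel"
    by (rule countable_imp_null_set_lborel)
  then have "AE t in lborel. cis t \<noteq> w"
    using AE_not_in by fastforce
  then show ?thesis
    by (subst AE_restrict_space_iff) (auto elim: eventually_mono)
qed

lemma measurable_cis [measurable]: "cis \<in> borel_measurable borel"
  by (intro borel_measurable_continuous_onI continuous_intros)

text \<open>Approximation from inside the disk: for \<open>\<bar>\<zeta>\<bar> = 1\<close>, \<open>\<bar>\<zeta> - w\<bar> / 2 \<le> \<bar>r \<zeta> - w\<bar>\<close> holds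
  uniformly in \<open>0 \<le> r < 1\<close>, and Fatou's lemma turns the mean value property for \<open>r < 1\<close> into integrability
  of the dominating function.\<close>

lemma circle_integral_ln_boundary:
  assumes w: "cmod w = 1"
  shows "has_bochner_integral circle_angles (\<lambda>t. ln (cmod (cis t - w))) 0"
proof -
  define r where "r = (\<lambda>n. real n / (real n + 1))"
  define s where "s = (\<lambda>n t. ln (cmod (of_real (r n) * cis t - w)))"
  define f where "f = (\<lambda>t. ln (cmod (cis t - w)))"
  have r: "0 \<le> r n" "r n < 1" for n
    by (auto simp: r_def field_simps)
  have r_lim: "r \<longlonglongrightarrow> 1"
    unfolding r_def by (rule LIMSEQ_n_over_Suc_n[unfolded of_nat_Suc add.commute[of 1]])
  have s_int: "has_bochner_integral circle_angles (s n) 0" for n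
    using circle_integral_ln[of "of_real (r n)" w] r[of n] w by (simp add: s_def max_def)
  have [measurable]: "f \<in> borel_measurable circle_angles" "s n \<in> borel_measurable circle_angles" for n
    unfolding f_def s_def by (auto intro!: measurable_restrict_space1)
  have pos: "0 < cmod (of_real (r n) * cis t - w)" for n t
    using r[of n] w norm_triangle_ineq3[of "of_real (r n) * cis t" w]
    by (auto simp: norm_mult)
  have s_le: "s n t \<le> ln 2" for n t
    using r[of n] w pos[of n t] norm_triangle_ineq4[of "of_real (r n) * cis t" w]
    by (auto simp: s_def norm_mult)
  have s_ge: "f t - ln 2 \<le> s n t" if "cis t \<noteq> w" for n t
  proof -
    \<comment> \<open>The detour through the point of radius \<open>r n\<close> costs
      \<open>1 - r n\<close>. Since \<open>w\<close> lies on the unit circle, that cost is at most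
      the distance from this point to \<open>w\<close>; this is the source of the factor 2.\<close>
    have "cmod (cis t - of_real (r n) * cis t) = 1 - r n"
      using r[of n] norm_mult[of "of_real (1 - r n)" "cis t"] norm_of_real[of "1 - r n", where ?'a = complex]
      by (simp add: algebra_simps)
    moreover have "1 - r n \<le> cmod (of_real (r n) * cis t - w)"
      using r[of n] w norm_triangle_ineq3[of "of_real (r n) * cis t" w] by (simp add: norm_mult)
    moreover have "cmod (cis t - w)
        \<le> cmod (cis t - of_real (r n) * cis t) + cmod (of_real (r n) * cis t - w)"
      by (rule norm_diff_triangle_ineq[THEN order_trans[rotated]]) simp
    ultimately have "cmod (cis t - w) / 2 \<le> cmod (of_real (r n) * cis t - w)"
      by simp
    then have "ln (cmod (cis t - w) / 2) \<le> s n t"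
      unfolding s_def using that pos by (subst ln_le_cancel_iff) auto
    then show ?thesis
      using that by (simp add: f_def ln_div)
  qed
  have s_lim: "(\<lambda>n. s n t) \<longlonglongrightarrow> f t" if "cis t \<noteq> w" for t
  proof -
    have "(\<lambda>n. ln (cmod (of_real (r n) * cis t - w))) \<longlonglongrightarrow> ln (cmod (of_real 1 * cis t - w))"
      using that by (intro tendsto_intros r_lim) auto
    then show ?thesis
      by (simp add: s_def f_def)
  qed
  have f_le: "f t \<le> ln 2" if "cis t \<noteq> w" for t
    using s_le by (intro LIMSEQ_le_const2[OF s_lim[OF that]]) auto
  have "integrable circle_angles (\<lambda>t. ln 2 - f t)"
  proof (rule integrableI_nonneg)
    show "AE t in circle_angles. 0 \<le> ln 2 - f t"
      using AE_circle_neq[of w] by eventually_elim (use f_le in simp)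
    have "(\<integral>\<^sup>+t. ennreal (ln 2 - f t) \<partial>circle_angles)
        = (\<integral>\<^sup>+t. liminf (\<lambda>n. ennreal (ln 2 - s n t)) \<partial>circle_angles)"
      using AE_circle_neq[of w]
    proof (intro nn_integral_cong_AE, eventually_elim)
      fix t assume "cis t \<noteq> w"
      then have "(\<lambda>n. ennreal (ln 2 - s n t)) \<longlonglongrightarrow> ennreal (ln 2 - f t)"
        by (intro tendsto_intros s_lim)
      then show "ennreal (ln 2 - f t) = liminf (\<lambda>n. ennreal (ln 2 - s n t))"
        using lim_imp_Liminf by (metis sequentially_bot)
    qed
    also have "\<dots> \<le> liminf (\<lambda>n. \<integral>\<^sup>+t. ennreal (ln 2 - s n t) \<partial>circle_angles)"
      by (intro nn_integral_liminf) measurable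
    also have "(\<lambda>n. \<integral>\<^sup>+t. ennreal (ln 2 - s n t) \<partial>circle_angles) = (\<lambda>n. ennreal (2 * pi * ln 2))"
    proof
      fix n
      have "has_bochner_integral circle_angles (\<lambda>t. ln 2 - s n t) (2 * pi * ln 2 - 0)"
        by (intro has_bochner_integral_diff circle_integral_const s_int)
      then show "(\<integral>\<^sup>+t. ennreal (ln 2 - s n t) \<partial>circle_angles) = ennreal (2 * pi * ln 2)"
        using s_le by (subst nn_integral_eq_integral) (auto simp: has_bochner_integral_iff)
    qed
    also have "liminf (\<lambda>n :: nat. ennreal (2 * pi * ln 2)) < \<infinity>"
      by (simp add: Liminf_const)
    finally show "(\<integral>\<^sup>+t. ennreal (ln 2 - f t) \<partial>circle_angles) < \<infinity>" .
  qed measurable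
  \<comment> \<open>The first summand bounds \<open>s n\<close> from above and the second bounds
    \<open>- s n\<close>; both are nonnegative almost everywhere, so the sum bounds the absolute
    value.\<close>
  then have dom: "integrable circle_angles (\<lambda>t. ln 2 + (ln 2 - f t))"
    by (intro Bochner_Integration.integrable_add has_bochner_integral_iff[THEN iffD1, THEN conjunct1, OF circle_integral_const])
  have lim: "AE t in circle_angles. (\<lambda>n. s n t) \<longlonglongrightarrow> f t"
    using AE_circle_neq[of w] by eventually_elim (rule s_lim)
  have bound: "AE t in circle_angles. norm (s n t) \<le> ln 2 + (ln 2 - f t)" for n
    using AE_circle_neq[of w]
  proof eventually_elim
    fix t assume "cis t \<noteq> w"
    moreover have "0 \<le> ln (2 :: real)"
      by simp
    ultimately show "norm (s n t) \<le> ln 2 + (ln 2 - f t)"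
      using s_le[of n t] s_ge[of t n] f_le[of t] unfolding real_norm_def abs_le_iff by linarith
  qed
  have "integrable circle_angles f"
    by (rule integrable_dominated_convergence[OF _ _ dom lim bound]) auto
  moreover have "(\<lambda>n. integral\<^sup>L circle_angles (s n)) \<longlonglongrightarrow> integral\<^sup>L circle_angles f"
    by (rule integral_dominated_convergence[OF _ _ dom lim bound]) auto
  moreover have "integral\<^sup>L circle_angles (s n) = 0" for n
    using s_int[of n] by (simp add: has_bochner_integral_iff)
  ultimately show ?thesis
    by (simp add: has_bochner_integral_iff LIMSEQ_const_iff f_def)
qed

lemma jensen_linear_factor:
  "has_bochner_integral circle_angles (\<lambda>t. ln (cmod (cis t - w))) (2 * pi * ln (max 1 (cmod w)))"
  using circle_integral_ln[of 1 w] circle_integral_ln_boundary[of w] by (cases "cmod w = 1") auto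

section \<open>Integrals over the unit disk: rotational averaging and linear factors\<close>

lemma nn_integral_disk_rotation:
  fixes f :: "complex \<Rightarrow> ennreal"
  assumes [measurable]: "f \<in> borel_measurable borel" and u: "cmod u = 1"
  shows "(\<integral>\<^sup>+z. f (u * z) \<partial>disk_measure) = (\<integral>\<^sup>+z. f z \<partial>disk_measure)"
proof -
  have "(\<integral>\<^sup>+z. f (u * z) \<partial>disk_measure) = (\<integral>\<^sup>+z. f (u * z) * indicator (ball 0 1) (u * z) \<partial>lborel)"
    by (auto simp: nn_integral_restrict_space indicator_def norm_mult u intro!: nn_integral_cong)
  also have "\<dots> = (\<integral>\<^sup>+z. f z * indicator (ball 0 1) z \<partial>distr lborel borel ((*) u))"
    using assms(1)
    by (subst nn_integral_distr) (auto intro!: borel_measurable_times_ennreal borel_measurable_indicator)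
  also have "\<dots> = (\<integral>\<^sup>+z. f z \<partial>disk_measure)"
    by (simp add: distr_lborel_complex_rotation[OF u] nn_integral_restrict_space)
  finally show ?thesis .
qed

lemma emeasure_circle_angles: "emeasure circle_angles {0..2 * pi} = ennreal (2 * pi)"
  by (simp add: space_restrict_space emeasure_restrict_space)

lemma emeasure_disk_measure: "emeasure disk_measure (ball 0 1) = ennreal pi"
  by (simp add: space_restrict_space emeasure_restrict_space emeasure_ball unit_ball_vol_2)

lemma finite_measure_circle_angles: "finite_measure circle_angles"
  by (rule finite_measureI) (simp add: emeasure_circle_angles)

lemma finite_measure_disk_measure: "finite_measure disk_measure"
  by (rule finite_measureI) (simp add: emeasure_disk_measure)

text \<open>After Tonelli, rotation invariance makes the integral over the disk independent of
  \<open>t\<close>, and \<open>2 * pi\<close> is the length of the angle interval. This takes the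
  place of polar coordinates.\<close>

lemma nn_integral_disk_circle_average:
  fixes f :: "complex \<Rightarrow> ennreal"
  assumes [measurable]: "f \<in> borel_measurable borel"
  shows "(\<integral>\<^sup>+z. (\<integral>\<^sup>+t. f (z * cis t) \<partial>circle_angles) \<partial>disk_measure)
    = ennreal (2 * pi) * (\<integral>\<^sup>+z. f z \<partial>disk_measure)"
proof -
  interpret circle: finite_measure circle_angles
    by (rule finite_measure_circle_angles)
  interpret disk: finite_measure disk_measure
    by (rule finite_measure_disk_measure)
  interpret pair_sigma_finite circle_angles disk_measure ..
  have [measurable]: "(\<lambda>t. t) \<in> measurable circle_angles borel" "(\<lambda>z. z) \<in> measurable disk_measure borel"
    by (auto intro!: measurable_restrict_space1)
  have "(\<lambda>(t, z). f (z * cis t)) \<in> borel_measurable (circle_angles \<Otimes>\<^sub>M disk_measure)"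
    by measurable
  then have "(\<integral>\<^sup>+z. (\<integral>\<^sup>+t. f (z * cis t) \<partial>circle_angles) \<partial>disk_measure)
      = (\<integral>\<^sup>+t. (\<integral>\<^sup>+z. f (z * cis t) \<partial>disk_measure) \<partial>circle_angles)"
    by (rule Fubini')
  also have "\<dots> = (\<integral>\<^sup>+t. (\<integral>\<^sup>+z. f z \<partial>disk_measure) \<partial>circle_angles)"
    using nn_integral_disk_rotation[OF assms, of "cis _"] by (simp add: mult.commute)
  also have "\<dots> = ennreal (2 * pi) * (\<integral>\<^sup>+z. f z \<partial>disk_measure)"
    by (simp add: emeasure_circle_angles) (rule mult.commute)
  finally show ?thesis .
qed

text \<open>Layer cake: \<open>- ln (max \<bar>z\<bar> b)\<close> is the integral of \<open>1 / r\<close> over \<open>b \<le> r \<le> 1\<close> with \<open>z \<in> cball 0 r\<close>.\<close>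

lemma nn_integral_disk_ln_max:
  assumes b: "0 \<le> b" "b < 1"
  shows "(\<integral>\<^sup>+z. ennreal (- ln (max (cmod z) b)) \<partial>disk_measure) = ennreal (pi * (1 - b\<^sup>2) / 2)"
proof -
  let ?k = "\<lambda>z r. ennreal (1 / r) * indicator {b..1} r * indicator {p. cmod (fst p) \<le> snd p} (z, r)"
  have [measurable]: "{p :: complex \<times> real. cmod (fst p) \<le> snd p} \<in> sets (lborel \<Otimes>\<^sub>M lborel)"
  proof -
    have "closed {p :: complex \<times> real. cmod (fst p) \<le> snd p}"
      by (intro closed_Collect_le continuous_intros)
    then have "{p :: complex \<times> real. cmod (fst p) \<le> snd p} \<in> sets lborel"
      by simp
    then show ?thesis
      by (simp only: lborel_prod)
  qed
  \<comment> \<open>The origin is left out because for \<open>b = 0\<close> the integral of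
    \<open>1 / r\<close> diverges there, whereas \<open>ln 0 = 0\<close>; a single point is
    null.\<close>
  have inner: "ennreal (- ln (max (cmod z) b)) * indicator (ball 0 1) z = (\<integral>\<^sup>+r. ?k z r \<partial>lborel)"
    if "z \<noteq> 0" for z
  proof (cases "cmod z \<le> 1")
    case True
    let ?m = "max (cmod z) b"
    have m: "0 < ?m" "?m \<le> 1"
      using that True b by (auto simp: less_max_iff_disj)
    have "(\<integral>\<^sup>+r. ?k z r \<partial>lborel) = (\<integral>\<^sup>+r. ennreal (1 / r) * indicator {?m..1} r \<partial>lborel)"
      by (intro nn_integral_cong) (auto simp: indicator_def)
    also have "\<dots> = ennreal (ln 1 - ln ?m)"
      using m by (intro nn_integral_FTC_Icc) (auto intro!: derivative_eq_intros)
    also have "\<dots> = ennreal (- ln ?m) * indicator (ball 0 1) z"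
      using True b by (auto simp: indicator_def max_def)
    finally show ?thesis ..
  next
    case False
    then have "(\<integral>\<^sup>+r. ?k z r \<partial>lborel) = (\<integral>\<^sup>+(r :: real). 0 \<partial>lborel)"
      by (intro nn_integral_cong) (auto simp: indicator_def)
    then show ?thesis
      using False by (simp add: indicator_def)
  qed
  have "(\<integral>\<^sup>+z. ennreal (- ln (max (cmod z) b)) \<partial>disk_measure)
      = (\<integral>\<^sup>+z. ennreal (- ln (max (cmod z) b)) * indicator (ball 0 1) z \<partial>lborel)"
    by (simp add: nn_integral_restrict_space)
  also have "\<dots> = (\<integral>\<^sup>+z. (\<integral>\<^sup>+r. ?k z r \<partial>lborel) \<partial>lborel)"
    using AE_lborel_singleton[of 0]
    by (intro nn_integral_cong_AE) (auto simp: inner elim!: eventually_mono)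
  also have "\<dots> = (\<integral>\<^sup>+r. (\<integral>\<^sup>+z. ?k z r \<partial>lborel) \<partial>lborel)"
    by (rule lborel_pair.Fubini'[symmetric]) measurable
  \<comment> \<open>The weight \<open>1 / r\<close> times the area \<open>pi * r\<^sup>2\<close> of
    \<open>cball 0 r\<close> leaves \<open>pi * r\<close>.\<close>
  also have "\<dots> = (\<integral>\<^sup>+r. ennreal (pi * r) * indicator {b..1} r \<partial>lborel)"
  proof (rule nn_integral_cong)
    fix r :: real
    have "(\<integral>\<^sup>+z. ?k z r \<partial>lborel)
        = (\<integral>\<^sup>+z. (ennreal (1 / r) * indicator {b..1} r) * indicator (cball (0 :: complex) r) z \<partial>lborel)"
      by (intro nn_integral_cong) (auto simp: indicator_def)
    also have "\<dots> = (ennreal (1 / r) * indicator {b..1} r) * emeasure lborel (cball (0 :: complex) r)"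
      by (rule nn_integral_cmult_indicator) simp
    also have "\<dots> = ennreal (pi * r) * indicator {b..1} r"
      using b by (auto simp: indicator_def emeasure_cball unit_ball_vol_2 ennreal_mult'[symmetric]
          power2_eq_square)
    finally show "(\<integral>\<^sup>+z. ?k z r \<partial>lborel) = ennreal (pi * r) * indicator {b..1} r" .
  qed
  also have "\<dots> = ennreal (pi * 1\<^sup>2 / 2 - pi * b\<^sup>2 / 2)"
    using b by (intro nn_integral_FTC_Icc) (auto intro!: derivative_eq_intros)
  also have "pi * 1\<^sup>2 / 2 - pi * b\<^sup>2 / 2 = pi * (1 - b\<^sup>2) / 2"
    by (simp add: field_simps)
  finally show ?thesis .
qed

lemma disk_integral_const: "has_bochner_integral disk_measure (\<lambda>_. k :: real) (pi * k)"
proof -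
  interpret finite_measure disk_measure
    by (rule finite_measure_disk_measure)
  have "measure disk_measure (ball 0 1) = pi"
    by (rule measure_eq_emeasure_eq_ennreal) (simp_all add: emeasure_disk_measure)
  then show ?thesis
    by (simp add: has_bochner_integral_iff)
qed

text \<open>Circles have area zero. This discards the points with \<open>cmod z = cmod w\<close>,
  which \<open>circle_integral_ln\<close> does not cover.\<close>

lemma AE_disk_norm_neq: "AE z in disk_measure. cmod z \<noteq> r"
proof -
  have "sphere (0 :: complex) r \<in> null_sets lborel"
    using negligible_sphere[of "0 :: complex" r]
    by (simp add: negligible_iff_null_sets null_sets_completion_iff)
  then have "AE z in lborel. z \<notin> sphere (0 :: complex) r"
    by (rule AE_not_in)
  then show ?thesis
    by (subst AE_restrict_space_iff) (auto elim: eventually_mono)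
qed

text \<open>Averaging over rotations replaces \<open>ln \<bar>z - w\<bar>\<close> by its circle mean \<open>ln (max \<bar>z\<bar> \<bar>w\<bar>)\<close>; the
  constant \<open>K\<close> makes the integrand nonnegative, so that Tonelli applies and yields integrability.\<close>

lemma areal_linear_factor:
  "has_bochner_integral disk_measure (\<lambda>z. ln (cmod (z - w)))
    (if cmod w < 1 then pi * ((cmod w)\<^sup>2 - 1) / 2 else pi * ln (cmod w))"
proof -
  define K where "K = ln (1 + cmod w)"
  define v where "v = (if cmod w < 1 then pi * ((cmod w)\<^sup>2 - 1) / 2 else pi * ln (cmod w))"
  define g where "g = (\<lambda>z. K - ln (cmod (z - w)))"
  have K: "0 \<le> K"
    by (simp add: K_def)
  have ge: "0 \<le> g z" if "cmod z < 1" for z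
  proof (cases "z = w")
    case False
    have "cmod (z - w) \<le> 1 + cmod w"
      using norm_triangle_ineq4[of z w] that by simp
    then have "ln (cmod (z - w)) \<le> ln (1 + cmod w)"
      using False by (subst ln_le_cancel_iff) (auto intro: add_pos_nonneg)
    then show ?thesis
      by (simp add: g_def K_def)
  \<comment> \<open>At \<open>z = w\<close> the convention \<open>ln 0 = 0\<close> gives
    \<open>g w = K\<close>, which is nonnegative.\<close>
  qed (use K in \<open>simp add: g_def\<close>)
  have [measurable]: "g \<in> borel_measurable borel"
    unfolding g_def by measurable
  have mean: "(\<integral>\<^sup>+t. ennreal (g (z * cis t)) \<partial>circle_angles)
      = ennreal (2 * pi * (K - ln (max (cmod z) (cmod w))))"
    if "cmod z \<noteq> cmod w" "cmod z < 1" for z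
  proof -
    have "has_bochner_integral circle_angles (\<lambda>t. g (z * cis t))
        (2 * pi * K - 2 * pi * ln (max (cmod z) (cmod w)))"
      unfolding g_def by (intro has_bochner_integral_diff circle_integral_const circle_integral_ln that)
    then have int: "integrable circle_angles (\<lambda>t. g (z * cis t))"
      and "(LINT t|circle_angles. g (z * cis t)) = 2 * pi * (K - ln (max (cmod z) (cmod w)))"
      by (simp_all add: has_bochner_integral_iff right_diff_distrib)
    moreover have "(\<integral>\<^sup>+t. ennreal (g (z * cis t)) \<partial>circle_angles)
        = ennreal (LINT t|circle_angles. g (z * cis t))"
      using ge that by (intro nn_integral_eq_integral int) (simp add: norm_mult)
    ultimately show ?thesis
      by simp
  qed
  have in_disk: "AE z in disk_measure. cmod z < 1"
    by (simp add: AE_restrict_space_iff)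
  have "ennreal (2 * pi) * (\<integral>\<^sup>+z. ennreal (g z) \<partial>disk_measure)
      = (\<integral>\<^sup>+z. (\<integral>\<^sup>+t. ennreal (g (z * cis t)) \<partial>circle_angles) \<partial>disk_measure)"
    by (rule nn_integral_disk_circle_average[symmetric]) measurable
  also have "\<dots> = (\<integral>\<^sup>+z. ennreal (2 * pi * (K - ln (max (cmod z) (cmod w)))) \<partial>disk_measure)"
    using AE_disk_norm_neq[of "cmod w"] in_disk
  proof (intro nn_integral_cong_AE, eventually_elim)
    fix z assume "cmod z \<noteq> cmod w" "cmod z < 1"
    then show "(\<integral>\<^sup>+t. ennreal (g (z * cis t)) \<partial>circle_angles)
        = ennreal (2 * pi * (K - ln (max (cmod z) (cmod w))))"
      by (rule mean)
  qed
  also have "\<dots> = ennreal (2 * pi * (pi * K - v))"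
  \<comment> \<open>For \<open>cmod w < 1\<close> the integrand splits into the nonnegative parts
    \<open>K\<close> and \<open>- ln (max (cmod z) (cmod w))\<close>, and the second is the
    layer-cake integral with \<open>b = cmod w\<close>. Otherwise the maximum is constantly
    \<open>cmod w\<close> on the disk.\<close>
  proof (cases "cmod w < 1")
    case True
    have meas: "(\<lambda>z. ennreal (- ln (max (cmod z) (cmod w)))) \<in> borel_measurable disk_measure"
      by (rule measurable_restrict_space1) measurable
    have neg: "ln (max (cmod z) (cmod w)) \<le> 0" if "cmod z < 1" "cmod z \<noteq> cmod w" for z
    proof -
      have "0 < max (cmod z) (cmod w)"
        using that norm_ge_zero[of z] norm_ge_zero[of w] by linarith
      then show ?thesis
        using that True by simp
    qed
    have "(\<integral>\<^sup>+z. ennreal (2 * pi * (K - ln (max (cmod z) (cmod w)))) \<partial>disk_measure)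
        = (\<integral>\<^sup>+z. ennreal (2 * pi * K) + ennreal (2 * pi) * ennreal (- ln (max (cmod z) (cmod w))) \<partial>disk_measure)"
      using AE_disk_norm_neq[of "cmod w"] in_disk
    proof (intro nn_integral_cong_AE, eventually_elim)
      fix z assume "cmod z \<noteq> cmod w" "cmod z < 1"
      then show "ennreal (2 * pi * (K - ln (max (cmod z) (cmod w))))
          = ennreal (2 * pi * K) + ennreal (2 * pi) * ennreal (- ln (max (cmod z) (cmod w)))"
        using neg[of z] K
        by (subst ennreal_mult'[symmetric], simp, subst ennreal_plus[symmetric])
          (auto simp: right_diff_distrib mult_nonneg_nonpos)
    qed
    also have "\<dots> = ennreal (2 * pi * K) * ennreal pi
        + ennreal (2 * pi) * ennreal (pi * (1 - (cmod w)\<^sup>2) / 2)"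
      using True meas
      by (subst nn_integral_add)
        (auto simp: nn_integral_cmult nn_integral_disk_ln_max emeasure_disk_measure
          intro!: borel_measurable_times_ennreal)
    also have "\<dots> = ennreal (2 * pi * K * pi + 2 * pi * (pi * (1 - (cmod w)\<^sup>2) / 2))"
      using K True by (subst ennreal_plus) (auto simp: ennreal_mult[symmetric] power_le_one abs_square_le_1)
    finally show ?thesis
      using True by (simp add: v_def algebra_simps diff_divide_distrib)
  next
    case False
    have "(\<integral>\<^sup>+z. ennreal (2 * pi * (K - ln (max (cmod z) (cmod w)))) \<partial>disk_measure)
        = (\<integral>\<^sup>+z. ennreal (2 * pi * (K - ln (cmod w))) \<partial>disk_measure)"
      using False in_disk by (intro nn_integral_cong_AE) (auto simp: max_def elim!: eventually_mono)
    also have "\<dots> = ennreal (2 * pi * (K - ln (cmod w)) * pi)"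
      by (simp add: emeasure_disk_measure ennreal_mult''[symmetric])
    finally show ?thesis
      using False by (simp add: v_def algebra_simps)
  qed
  finally have "ennreal (2 * pi) * (\<integral>\<^sup>+z. ennreal (g z) \<partial>disk_measure)
      = ennreal (2 * pi) * ennreal (pi * K - v)"
    by (simp add: ennreal_mult')
  then have "(\<integral>\<^sup>+z. ennreal (g z) \<partial>disk_measure) = ennreal (pi * K - v)"
    by (simp add: ennreal_mult_cancel_left)
  \<comment> \<open>Since \<open>ennreal\<close> sends negative numbers to 0, the sign of
    \<open>pi * K - v\<close> must be known before this value can be read as a real
    integral.\<close>
  moreover have "v \<le> pi * K"
  proof (cases "cmod w < 1")
    case True
    then have "v \<le> 0"
      by (simp add: v_def mult_nonneg_nonpos abs_square_le_1)
    with K show ?thesis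
      by (meson mult_nonneg_nonneg order_trans pi_ge_zero)
  next
    case False
    then have "ln (cmod w) \<le> K"
      unfolding K_def by (intro ln_mono) auto
    with False show ?thesis
      by (simp add: v_def)
  qed
  moreover have "AE z in disk_measure. 0 \<le> g z"
    using in_disk by eventually_elim (rule ge)
  ultimately have "has_bochner_integral disk_measure g (pi * K - v)"
    by (intro has_bochner_integral_nn_integral) (auto intro!: measurable_restrict_space1)
  from has_bochner_integral_diff[OF disk_integral_const[of K] this]
  show ?thesis
    by (simp add: g_def v_def)
qed

section \<open>From linear factors to polynomials\<close>

text \<open>Off the null set where \<open>\<phi>\<close> hits a root, the logarithm turns the
  factorization into a sum. The map \<open>\<phi>\<close> is \<open>cis\<close> for the circle and
  the identity for the disk.\<close>

lemma has_bochner_integral_ln_poly_prod: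
  fixes \<phi> :: "'a \<Rightarrow> complex" and z :: "'i \<Rightarrow> complex"
  assumes c: "c \<noteq> 0" and \<phi> [measurable]: "\<phi> \<in> borel_measurable M"
    and const: "has_bochner_integral M (\<lambda>_. ln (cmod c)) k"
    and factor: "\<And>j. j \<in> J \<Longrightarrow> has_bochner_integral M (\<lambda>x. ln (cmod (\<phi> x - z j))) (I j)"
    and neq: "\<And>j. j \<in> J \<Longrightarrow> AE x in M. \<phi> x \<noteq> z j"
    and J: "finite J"
  shows "has_bochner_integral M (\<lambda>x. ln (cmod (poly (smult c (\<Prod>j\<in>J. [:- z j, 1:])) (\<phi> x))))
    (k + (\<Sum>j\<in>J. I j))"
proof -
  let ?f = "\<lambda>x. ln (cmod c) + (\<Sum>j\<in>J. ln (cmod (\<phi> x - z j)))"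
  let ?g = "\<lambda>x. ln (cmod (poly (smult c (\<Prod>j\<in>J. [:- z j, 1:])) (\<phi> x)))"
  have "has_bochner_integral M ?f (k + (\<Sum>j\<in>J. I j))"
    by (intro has_bochner_integral_add const has_bochner_integral_sum factor)
  moreover have "?f \<in> borel_measurable M"
    by measurable
  moreover have "(\<lambda>x. poly (smult c (\<Prod>j\<in>J. [:- z j, 1:])) (\<phi> x)) \<in> borel_measurable M"
    by (rule measurable_compose[OF \<phi>], intro borel_measurable_continuous_onI continuous_intros)
  then have "?g \<in> borel_measurable M"
    by measurable
  moreover have "AE x in M. \<forall>j\<in>J. \<phi> x \<noteq> z j"
    using neq J by (simp add: AE_finite_all)
  then have "AE x in M. ?f x = ?g x"
  proof eventually_elim
    case (elim x)
    have "poly (smult c (\<Prod>j\<in>J. [:- z j, 1:])) (\<phi> x) = c * (\<Prod>j\<in>J. \<phi> x - z j)"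
      by (simp add: poly_prod)
    moreover have "(\<Prod>j\<in>J. cmod (\<phi> x - z j)) \<noteq> 0"
      using elim J by simp
    moreover have "ln (\<Prod>j\<in>J. cmod (\<phi> x - z j)) = (\<Sum>j\<in>J. ln (cmod (\<phi> x - z j)))"
      using elim J by (intro ln_prod) auto
    ultimately show ?case
      using c by (simp add: norm_mult ln_mult prod_norm[symmetric])
  qed
  ultimately show ?thesis
    using has_bochner_integral_cong_AE[of ?f M ?g] by blast
qed

lemma mahler_measure_jensen:
  assumes "c \<noteq> 0" "finite J"
  shows "mahler_measure (smult c (\<Prod>j\<in>J. [:- z j, 1:])) = cmod c * (\<Prod>j\<in>J. max 1 (cmod (z j)))"
proof -
  let ?P = "smult c (\<Prod>j\<in>J. [:- z j, 1:])"
  have "has_bochner_integral circle_angles (\<lambda>t. ln (cmod (poly ?P (cis t))))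
      (2 * pi * ln (cmod c) + (\<Sum>j\<in>J. 2 * pi * ln (max 1 (cmod (z j)))))"
    using assms by (intro has_bochner_integral_ln_poly_prod circle_integral_const
        jensen_linear_factor AE_circle_neq) (auto intro!: measurable_restrict_space1)
  then have "(LINT t|circle_angles. ln (cmod (poly ?P (cis t))))
      = 2 * pi * (ln (cmod c) + (\<Sum>j\<in>J. ln (max 1 (cmod (z j)))))"
    by (simp add: has_bochner_integral_iff sum_distrib_left distrib_left)
  moreover have "(LBINT t=0..2*pi. ln (cmod (poly ?P (exp (\<i> * of_real t)))))
      = (LINT t|circle_angles. ln (cmod (poly ?P (cis t))))"
    unfolding zero_ereal_def
    by (simp add: interval_integral_Icc set_lebesgue_integral_def integral_restrict_space cis_conv_exp)
  moreover have "ln (\<Prod>j\<in>J. max 1 (cmod (z j))) = (\<Sum>j\<in>J. ln (max 1 (cmod (z j))))"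
    using assms by (intro ln_prod) auto
  ultimately have "mahler_measure ?P = exp (ln (cmod c) + ln (\<Prod>j\<in>J. max 1 (cmod (z j))))"
    by (simp add: mahler_measure_def)
  moreover have "0 < (\<Prod>j\<in>J. max 1 (cmod (z j)))"
    by (intro prod_pos) auto
  ultimately show ?thesis
    using assms by (simp add: exp_add)
qed

text \<open>Compare the two means root by root: for \<open>1 \<le> cmod (z j)\<close> both equal
  \<open>ln (cmod (z j))\<close>, while for a root inside the disk the circle mean is 0 and the
  areal mean is half of \<open>(cmod (z j))\<^sup>2 - 1\<close>. The term \<open>?e j\<close> is
  this difference.\<close>

lemma areal_mahler_measure_eq:
  assumes "c \<noteq> 0" "finite J"
  shows "areal_mahler_measure (smult c (\<Prod>j\<in>J. [:- z j, 1:]))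
    = mahler_measure (smult c (\<Prod>j\<in>J. [:- z j, 1:]))
      * exp (1 / 2 * (\<Sum>j | j \<in> J \<and> cmod (z j) < 1. (cmod (z j))\<^sup>2 - 1))"
proof -
  let ?P = "smult c (\<Prod>j\<in>J. [:- z j, 1:])"
  let ?e = "\<lambda>j. if cmod (z j) < 1 then 1 / 2 * ((cmod (z j))\<^sup>2 - 1) else 0"
  have "AE x in disk_measure. x \<noteq> w" for w
    using AE_disk_norm_neq[of "cmod w"] by eventually_elim auto
  then have "has_bochner_integral disk_measure (\<lambda>x. ln (cmod (poly ?P x)))
      (pi * ln (cmod c) + (\<Sum>j\<in>J. if cmod (z j) < 1 then pi * ((cmod (z j))\<^sup>2 - 1) / 2
        else pi * ln (cmod (z j))))"
    using assms by (intro has_bochner_integral_ln_poly_prod disk_integral_const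
        areal_linear_factor) (auto intro!: measurable_restrict_space1)
  then have "(LINT x|disk_measure. ln (cmod (poly ?P x)))
      = pi * ln (cmod c) + (\<Sum>j\<in>J. pi * (ln (max 1 (cmod (z j))) + ?e j))"
    unfolding has_bochner_integral_iff by (auto simp: max_def intro!: sum.cong)
  also have "\<dots> = pi * (ln (cmod c) + (\<Sum>j\<in>J. ln (max 1 (cmod (z j)))) + (\<Sum>j\<in>J. ?e j))"
    by (simp add: sum_distrib_left sum.distrib distrib_left)
  also have "(\<Sum>j\<in>J. ln (max 1 (cmod (z j)))) = ln (\<Prod>j\<in>J. max 1 (cmod (z j)))"
    using assms by (intro ln_prod[symmetric]) auto
  also have "(\<Sum>j\<in>J. ?e j) = (\<Sum>j | j \<in> J \<and> cmod (z j) < 1. 1 / 2 * ((cmod (z j))\<^sup>2 - 1))"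
    using assms by (simp add: sum.If_cases Int_def)
  finally have "areal_mahler_measure ?P = exp (ln (cmod c) + ln (\<Prod>j\<in>J. max 1 (cmod (z j)))
      + 1 / 2 * (\<Sum>j | j \<in> J \<and> cmod (z j) < 1. (cmod (z j))\<^sup>2 - 1))"
    by (simp add: areal_mahler_measure_def set_lebesgue_integral_def integral_restrict_space
        sum_distrib_left)
  moreover have "0 < (\<Prod>j\<in>J. max 1 (cmod (z j)))"
    by (intro prod_pos) auto
  ultimately show ?thesis
    using assms by (simp add: exp_add mahler_measure_jensen)
qed

theorem theorem1p1:
  fixes P :: "complex poly" and n :: nat and a z :: "nat \<Rightarrow> complex"
  assumes "P = smult (a n) (\<Prod>j=1..n. [:- z j, 1:])"
    and "P = (\<Sum>k=0..n. monom (a k) k)"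
    and "a n \<noteq> 0"
  shows "((\<forall>w\<in>ball 0 1. poly P w \<noteq> 0) \<longrightarrow>
            areal_mahler_measure P = mahler_measure P \<and> mahler_measure P = cmod (a 0)) \<and>
         (\<not> (\<forall>w\<in>ball 0 1. poly P w \<noteq> 0) \<longrightarrow>
            areal_mahler_measure P =
              mahler_measure P * exp (1 / 2 * (\<Sum>j | j \<in> {1..n} \<and> cmod (z j) < 1. ((cmod (z j))\<^sup>2 - 1))))"
proof -
  \<comment> \<open>This identity holds wherever the roots lie; without roots in the disk the sum is
    empty and the exponential factor is 1.\<close>
  have areal: "areal_mahler_measure P = mahler_measure P
      * exp (1 / 2 * (\<Sum>j | j \<in> {1..n} \<and> cmod (z j) < 1. ((cmod (z j))\<^sup>2 - 1)))"
    unfolding assms(1) using assms(3) by (intro areal_mahler_measure_eq) auto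
  have "areal_mahler_measure P = mahler_measure P \<and> mahler_measure P = cmod (a 0)"
    if noroot: "\<forall>w\<in>ball 0 1. poly P w \<noteq> 0"
  proof -
    have root: "poly P (z j) = 0" if "j \<in> {1..n}" for j
      using that by (auto simp: assms(1) poly_prod)
    have outside: "1 \<le> cmod (z j)" if "j \<in> {1..n}" for j
      using root[OF that] noroot by (cases "cmod (z j) < 1") auto
    \<comment> \<open>Evaluating both forms of \<open>P\<close> at 0 expresses
      \<open>cmod (a 0)\<close> as \<open>cmod (a n)\<close> times the product of the moduli of the
      roots. As none is below 1, this is Jensen's product of maxima.\<close>
    have "a 0 = poly P 0"
      by (simp add: assms(2) poly_0_coeff_0 coeff_sum)
    also have "cmod \<dots> = cmod (a n) * (\<Prod>j=1..n. cmod (z j))"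
      by (simp add: assms(1) poly_prod norm_mult prod_norm[symmetric])
    also have "\<dots> = mahler_measure P"
      unfolding assms(1) using assms(3) outside
      by (subst mahler_measure_jensen) (auto intro!: prod.cong simp: max_def)
    finally have "mahler_measure P = cmod (a 0)" ..
    moreover have empty: "{j. j \<in> {1..n} \<and> cmod (z j) < 1} = {}"
      using outside by force
    have "areal_mahler_measure P = mahler_measure P"
      using areal unfolding empty by simp
    ultimately show ?thesis by simp
  qed
  with areal show ?thesis by blast
qed

end
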